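(* Let $\mu_*=\frac{5+\sqrt{33}}{2}=5.3722\ldots$ and let $\mu^*=5.4207\ldots$ be the largest real root of $2x^4-14x^3+19x^2-10x-1$. Let $I=[\mu_*,\mu^*]$. Then for every $\mu\in I$ and every $k\ge 3$, the $k$-th caterpillar of the classic Laplacian Shearer sequence associated with $\mu$ is $$G_k(\mu)=[3,1,1,\dots,1,2],$$ i.e. $r_1=3$, $r_j=1$ for $2\le j\le k-1$, and $r_k=2$.
   Context: The caterpillar $[r_1,\dots,r_k]$ ($r_i\ge 0$ integers) is the tree obtained from a path $v_1v_2\cdots v_k$ by attaching $r_i$ pendant vertices (leaves) at $v_i$ for each $i$. Classic Laplacian Shearer sequence: given $\mu$, put $\theta'=\frac{-(\mu-2)+\sqrt{(\mu-2)^2-4}}{2}$ and $\psi(t)=2-\mu-\frac1t$ for $t\ne0$. For each $k\ge2$, $G_k(\mu)=[r_1,\dots,r_k]$ where $r_1=\left\lfloor\frac{\mu-1}{\mu}(\theta'-(1-\mu))\right\rfloor$, $S_1=1-\mu+r_1\frac{\mu}{\mu-1}$; for $2\le j\le k-1$: $r_j=\left\lfloor\frac{\mu-1}{\mu}(\theta'-\psi(S_{j-1}))\right\rfloor$, $S_j=\psi(S_{j-1})+r_j\frac{\mu}{\mu-1}$; and $r_k=\left\lfloor\frac{\mu-1}{\mu}(\theta'+1-\psi(S_{k-1}))\right\rfloor$. *)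

theory Defs
  imports "HOL-Analysis.Analysis" "HOL-Computational_Algebra.Polynomial"
begin

text \<open>
  A simple graph is a pair of a vertex set and a set of two-element edges.  In the caterpillar
  \<open>[r\<^sub>1, \<dots>, r\<^sub>k]\<close> the vertex \<open>(i, 0)\<close> is the path vertex \<open>v\<^sub>i\<close>, and \<open>(i, l)\<close> with
  \<open>1 \<le> l \<le> r\<^sub>i\<close> are the pendant vertices attached to it.  List positions start at 0, whence
  \<open>rs ! (i - 1)\<close>.
\<close>

type_synonym 'a graph = "'a set \<times> 'a set set"

definition caterpillar :: "nat list \<Rightarrow> (nat \<times> nat) graph" where
  "caterpillar rs =
    ({(i, l) | i l. 1 \<le> i \<and> i \<le> length rs \<and> l \<le> rs ! (i - 1)},
     {{(i, 0), (i + 1, 0)} | i. 1 \<le> i \<and> i < length rs} \<union>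
     {{(i, 0), (i, l)} | i l. 1 \<le> i \<and> i \<le> length rs \<and> 1 \<le> l \<and> l \<le> rs ! (i - 1)})"

definition shearer_theta :: "real \<Rightarrow> real" where
  "shearer_theta \<mu> = (- (\<mu> - 2) + sqrt ((\<mu> - 2)\<^sup>2 - 4)) / 2"

text \<open>
  Only meant for \<open>t \<noteq> 0\<close>.  By \<open>shearer_S_neg\<close> below, the sequence never evaluates it at 0
  when \<open>\<mu> \<ge> 4\<close>.
\<close>

definition shearer_psi :: "real \<Rightarrow> real \<Rightarrow> real" where
  "shearer_psi \<mu> t = 2 - \<mu> - 1 / t"

text \<open>
  The values \<open>r\<^sub>j\<close> and \<open>S\<^sub>j\<close> for \<open>1 \<le> j \<le> k - 1\<close> do not depend on \<open>k\<close>; only the last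
  \<open>r\<^sub>k\<close> follows another formula (see \<open>shearer_r\<close>).  Index 0 carries dummy values.  The
  \<open>r\<^sub>j\<close> are integers, not naturals, so that nothing is truncated by the definition.
\<close>

fun shearer_r_inner :: "real \<Rightarrow> nat \<Rightarrow> int" and shearer_S :: "real \<Rightarrow> nat \<Rightarrow> real" where
  "shearer_r_inner \<mu> 0 = 0"
| "shearer_r_inner \<mu> (Suc 0) = \<lfloor>(\<mu> - 1) / \<mu> * (shearer_theta \<mu> - (1 - \<mu>))\<rfloor>"
| "shearer_r_inner \<mu> (Suc (Suc j)) =
     \<lfloor>(\<mu> - 1) / \<mu> * (shearer_theta \<mu> - shearer_psi \<mu> (shearer_S \<mu> (Suc j)))\<rfloor>"
| "shearer_S \<mu> 0 = 0"
| "shearer_S \<mu> (Suc 0) = 1 - \<mu> + of_int (shearer_r_inner \<mu> (Suc 0)) * (\<mu> / (\<mu> - 1))"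
| "shearer_S \<mu> (Suc (Suc j)) =
     shearer_psi \<mu> (shearer_S \<mu> (Suc j)) +
       of_int (shearer_r_inner \<mu> (Suc (Suc j))) * (\<mu> / (\<mu> - 1))"

definition shearer_r :: "real \<Rightarrow> nat \<Rightarrow> nat \<Rightarrow> int" where
  "shearer_r \<mu> k j =
    (if j = k
     then \<lfloor>(\<mu> - 1) / \<mu> * (shearer_theta \<mu> + 1 - shearer_psi \<mu> (shearer_S \<mu> (k - 1)))\<rfloor>
     else shearer_r_inner \<mu> j)"

definition shearer_G :: "real \<Rightarrow> nat \<Rightarrow> (nat \<times> nat) graph" where
  "shearer_G \<mu> k = caterpillar (map (\<lambda>j. nat (shearer_r \<mu> k j)) [1..<k + 1])"

definition mu_lower :: real where
  "mu_lower = (5 + sqrt 33) / 2"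

definition mu_upper :: real where
  "mu_upper = Max {x. poly [:-1, -10, 19, -14, 2:] x = 0}"

lemma shearer_theta_neg:
  assumes "\<mu> \<ge> 4"
  shows "shearer_theta \<mu> < 0"
proof -
  have "sqrt ((\<mu> - 2)\<^sup>2 - 4) < sqrt ((\<mu> - 2)\<^sup>2)"
    by (rule real_sqrt_less_mono) simp
  also have "\<dots> = \<mu> - 2"
    using assms by simp
  finally show ?thesis
    by (simp add: shearer_theta_def)
qed

lemma shearer_S_neg:
  assumes "\<mu> \<ge> 4" and "j \<ge> 1"
  shows "shearer_S \<mu> j < 0"
proof -
  have bound: "a + of_int \<lfloor>(\<mu> - 1) / \<mu> * (shearer_theta \<mu> - a)\<rfloor> * (\<mu> / (\<mu> - 1)) < 0" for a
  proof -
    have "of_int \<lfloor>(\<mu> - 1) / \<mu> * (shearer_theta \<mu> - a)\<rfloor> * (\<mu> / (\<mu> - 1))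
        \<le> (\<mu> - 1) / \<mu> * (shearer_theta \<mu> - a) * (\<mu> / (\<mu> - 1))"
      using assms(1) by (intro mult_right_mono) auto
    also have "\<dots> = shearer_theta \<mu> - a"
      using assms(1) by simp
    finally show ?thesis
      using shearer_theta_neg[OF assms(1)] by linarith
  qed
  obtain i where i: "j = Suc i"
    using assms(2) by (cases j) auto
  show ?thesis
    unfolding i using bound by (cases i) simp_all
qed

lemma mu_lower_decimal: "5.3722 < mu_lower" "mu_lower < 5.3723"
proof -
  have "5.7444 < sqrt 33"
    by (rule real_less_rsqrt) (simp add: power2_eq_square)
  moreover have "sqrt 33 < 5.7446"
    by (rule real_less_lsqrt) (simp_all add: power2_eq_square)
  ultimately show "5.3722 < mu_lower" "mu_lower < 5.3723"
    by (simp_all add: mu_lower_def)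
qed

lemma mu_upper_decimal: "5.4207 < mu_upper" "mu_upper < 5.4208"
proof -
  define p :: "real poly" where "p = [:-1, -10, 19, -14, 2:]"
  have fin: "finite {x. poly p x = 0}"
    by (rule poly_roots_finite) (simp add: p_def)
  have pos: "poly p x > 0" if "x \<ge> 5.4208" for x :: real
  proof -
    define y where "y = x - 5.4208"
    have y: "y \<ge> 0" and x: "x = y + 5.4208"
      using that by (auto simp: y_def)
    have "poly p x = poly (p \<circ>\<^sub>p [:5.4208, 1:]) y"
      by (simp add: poly_pcompose x algebra_simps)
    also have "\<dots> > 0"
      using y by (simp add: p_def pcompose_pCons) (intro add_pos_nonneg mult_nonneg_nonneg add_nonneg_nonneg; simp)
    finally show ?thesis .
  qed
  have "poly p 5.4207 < 0"
    by (simp add: p_def)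
  from poly_IVT_pos[OF _ this pos[of "5.4208"]]
  obtain x where x: "5.4207 < x" "poly p x = 0"
    by auto
  have "x \<le> Max {x. poly p x = 0}"
    using fin x by (intro Max_ge) auto
  with x show "5.4207 < mu_upper"
    by (simp add: mu_upper_def p_def)
  have "Max {x. poly p x = 0} \<in> {x. poly p x = 0}"
    using fin x by (intro Max_in) auto
  then have "Max {x. poly p x = 0} < 5.4208"
    using pos[of "Max {x. poly p x = 0}"] by (cases "Max {x. poly p x = 0} \<ge> 5.4208") auto
  then show "mu_upper < 5.4208"
    by (simp add: mu_upper_def p_def)
qed

end

theory Submission
  imports Defs
begin

text \<open>
  Write \<open>c = \<mu> / (\<mu> - 1)\<close> and let \<open>F t = \<psi> t + c\<close>, which is increasing on the negative axis.
  As long as \<open>r\<^sub>j = 1\<close>, we have \<open>S\<^sub>j = F S\<^sub>j\<^sub>-\<^sub>1\<close>, and the floors take the required values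
  as soon as all \<open>S\<^sub>j\<close> lie in \<open>(\<theta>' - c, S\<^sub>1]\<close>.  This interval is invariant under \<open>F\<close>
  precisely because \<open>F S\<^sub>1 \<le> S\<^sub>1\<close>, which amounts to \<open>\<mu> \<ge> \<mu>\<^sub>*\<close>, and
  \<open>F (\<theta>' - c) \<ge> \<theta>' - c\<close>, which amounts to the sign condition on the quartic defining \<open>\<mu>\<^sup>*\<close>.
\<close>

lemma floor_scaled_eqI:
  assumes "\<mu> > (1::real)"
    and "of_int n * (\<mu> / (\<mu> - 1)) \<le> x" and "x < (of_int n + 1) * (\<mu> / (\<mu> - 1))"
  shows "\<lfloor>(\<mu> - 1) / \<mu> * x\<rfloor> = n"
  using assms by (intro floor_unique) (auto simp: field_simps)

text \<open>For nonzero \<open>\<theta>'\<close> this is the fixed-point equation of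
  \<open>shearer_psi \<mu>\<close>. It lets later arguments reduce powers of
  \<open>\<theta>'\<close> without touching the square root.\<close>

lemma shearer_theta_root:
  assumes "\<mu> \<ge> 4"
  shows "(shearer_theta \<mu>)\<^sup>2 + (\<mu> - 2) * shearer_theta \<mu> + 1 = 0"
proof -
  define s where "s = sqrt ((\<mu> - 2)\<^sup>2 - 4)"
  have "2\<^sup>2 \<le> (\<mu> - 2)\<^sup>2"
    using assms by (intro power_mono) auto
  then have "s\<^sup>2 = (\<mu> - 2)\<^sup>2 - 4"
    by (simp add: s_def)
  then show ?thesis
    unfolding shearer_theta_def s_def[symmetric] by (simp add: power2_eq_square field_simps)
qed

lemma shearer_theta_gt:
  assumes "\<mu> \<ge> 5"
  shows "shearer_theta \<mu> > - 0.4"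
proof -
  \<comment> \<open>After squaring, this is just \<mu> > 4.9.\<close>
  have "\<mu> - 2.8 < sqrt ((\<mu> - 2)\<^sup>2 - 4)"
    by (rule real_less_rsqrt) (use assms in \<open>simp add: power2_eq_square algebra_simps\<close>)
  then show ?thesis
    by (simp add: shearer_theta_def)
qed

lemma mu_lower_quadratic:
  assumes "\<mu> \<ge> mu_lower"
  shows "\<mu>\<^sup>2 - 5 * \<mu> - 2 \<ge> 0"
proof -
  have "(sqrt 33)\<^sup>2 \<le> (2 * \<mu> - 5)\<^sup>2"
    using assms by (intro power_mono) (auto simp: mu_lower_def)
  then show ?thesis
    by (simp add: power2_eq_square algebra_simps)
qed

text \<open>With u the largest root, the quartic at \<mu> equals (\<mu> - u) g, where g is the
  divided difference. Expanded around 5 in both variables, g has only nonnegative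
  coefficients.\<close>

lemma mu_upper_quartic:
  assumes "5 \<le> \<mu>" "\<mu> \<le> mu_upper"
  shows "2 * \<mu> ^ 4 - 14 * \<mu> ^ 3 + 19 * \<mu>\<^sup>2 - 10 * \<mu> - 1 \<le> 0"
proof -
  let ?p = "[:-1, -10, 19, -14, 2:] :: real poly"
  define u where "u = mu_upper"
  have "{x. poly ?p x = 0} \<noteq> {}"
  proof -
    have "poly ?p 5 < 0" "poly ?p 6 > 0" by simp_all
    from poly_IVT_pos[OF _ this] show ?thesis by auto
  qed
  moreover have "finite {x. poly ?p x = 0}"
    by (rule poly_roots_finite) simp
  ultimately have "u \<in> {x. poly ?p x = 0}"
    unfolding u_def mu_upper_def by (rule Max_in[rotated])
  then have root: "2 * u ^ 4 - 14 * u ^ 3 + 19 * u\<^sup>2 - 10 * u - 1 = 0"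
    by (simp add: algebra_simps power_numeral_reduce)
  define a b where "a = \<mu> - 5" and "b = u - 5"
  have ab: "a \<ge> 0" "b \<ge> 0" and sub: "\<mu> = a + 5" "u = b + 5"
    using assms by (auto simp: a_def b_def u_def)
  define g where "g = 2 * (\<mu> ^ 3 + \<mu>\<^sup>2 * u + \<mu> * u\<^sup>2 + u ^ 3) - 14 * (\<mu>\<^sup>2 + \<mu> * u + u\<^sup>2) + 19 * (\<mu> + u) - 10"
  have "g = 2 * (a ^ 3 + a\<^sup>2 * b + a * b\<^sup>2 + b ^ 3) + 26 * (a\<^sup>2 + a * b + b\<^sup>2) + 109 * (a + b) + 130"
    by (simp add: g_def sub algebra_simps power_numeral_reduce)
  then have "g \<ge> 0"
    using ab by simp
  moreover have "2 * \<mu> ^ 4 - 14 * \<mu> ^ 3 + 19 * \<mu>\<^sup>2 - 10 * \<mu> - 1 = (\<mu> - u) * g"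
    using root by (simp add: g_def algebra_simps power_numeral_reduce)
  ultimately show ?thesis
    using assms by (simp add: u_def mult_nonpos_nonneg)
qed

lemma shearer_psi_mono:
  assumes "s \<le> t" "t < 0"
  shows "shearer_psi \<mu> s \<le> shearer_psi \<mu> t"
  using assms by (simp add: shearer_psi_def field_simps)

lemma shearer_psi_strict_mono:
  assumes "s < t" "t < 0"
  shows "shearer_psi \<mu> s < shearer_psi \<mu> t"
  using assms by (simp add: shearer_psi_def field_simps)

text \<open>The argument of \<open>shearer_psi\<close> is \<open>S\<^sub>1\<close>, so this is
  \<open>F S\<^sub>1 \<le> S\<^sub>1\<close>. Multiplying by the negative number
  \<open>S\<^sub>1\<close> turns it into the sign of the quadratic whose larger root is
  \<open>mu_lower\<close>.\<close>

lemma shearer_psi_le_upper: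
  assumes "\<mu> \<in> {mu_lower..mu_upper}"
  defines "c \<equiv> \<mu> / (\<mu> - 1)"
  shows "shearer_psi \<mu> (1 - \<mu> + 3 * c) \<le> 1 - \<mu> + 2 * c"
proof -
  have \<mu>: "5.3722 < \<mu>" "\<mu> < 5.4208"
    using assms mu_lower_decimal mu_upper_decimal by auto
  define S where "S = 1 - \<mu> + 3 * c"
  have S: "S < 0"
  proof -
    have "c < 1.25" using \<mu> by (simp add: c_def field_simps)
    then show ?thesis using \<mu> by (simp add: S_def)
  qed
  have "S * (1 - 2 * c) - 1 = \<mu> * (\<mu>\<^sup>2 - 5 * \<mu> - 2) / (\<mu> - 1)\<^sup>2"
    using \<mu> by (simp add: S_def c_def divide_simps) (simp add: power2_eq_square algebra_simps)
  also have "\<dots> \<ge> 0"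
    using mu_lower_quadratic[of \<mu>] assms \<mu> by simp
  finally have "1 - 2 * c \<le> 1 / S"
    using S by (simp add: field_simps)
  then show ?thesis
    by (simp add: shearer_psi_def S_def)
qed

text \<open>Substituting 2 - \<mu> = \<theta> + 1 / \<theta> reduces the claim to
  \<open>2 * \<theta> * (\<theta> - c) \<ge> 1\<close>. The quadratic equation of \<theta> makes
  this linear: \<open>\<theta> \<le> - 3 / (2 * m)\<close>.\<close>

lemma shearer_psi_ge_lower:
  assumes "\<mu> \<in> {mu_lower..mu_upper}"
  defines "c \<equiv> \<mu> / (\<mu> - 1)"
  shows "shearer_psi \<mu> (shearer_theta \<mu> - c) \<ge> shearer_theta \<mu> - 2 * c"
proof -
  have \<mu>: "5.3722 < \<mu>" "\<mu> < 5.4208"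
    using assms mu_lower_decimal mu_upper_decimal by auto
  define \<theta> where "\<theta> = shearer_theta \<mu>"
  have \<theta>: "\<theta> < 0" "\<theta> > - 0.4" and root: "\<theta>\<^sup>2 + (\<mu> - 2) * \<theta> + 1 = 0"
    using shearer_theta_neg[of \<mu>] shearer_theta_gt[of \<mu>] shearer_theta_root[of \<mu>] \<mu>
    by (auto simp: \<theta>_def)
  have c: "c > 1" using \<mu> by (simp add: c_def field_simps)
  define m where "m = \<mu> - 2 + c"
  have m: "m > 3" using \<mu> c by (simp add: m_def)
  \<comment> \<open>The threshold for \<theta>. The quadratic with root \<theta>, evaluated at y, is
    the negated quartic up to positive factors.\<close>
  define y where "y = - 3 / (2 * m)"
  have y: "y > - 1" using m by (simp add: y_def field_simps)
  have "(4 * m\<^sup>2 - 6 * (\<mu> - 2) * m + 9) * (\<mu> - 1)\<^sup>2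
      = - (2 * \<mu> ^ 4 - 14 * \<mu> ^ 3 + 19 * \<mu>\<^sup>2 - 10 * \<mu> - 1)"
  proof -
    have "m * (\<mu> - 1) = \<mu>\<^sup>2 - 2 * \<mu> + 2"
      using \<mu> by (simp add: m_def c_def divide_simps) (simp add: power2_eq_square algebra_simps)
    then have "(4 * m\<^sup>2 - 6 * (\<mu> - 2) * m + 9) * (\<mu> - 1)\<^sup>2
        = 4 * (\<mu>\<^sup>2 - 2 * \<mu> + 2)\<^sup>2 - 6 * (\<mu> - 2) * (\<mu> - 1) * (\<mu>\<^sup>2 - 2 * \<mu> + 2) + 9 * (\<mu> - 1)\<^sup>2"
      by algebra
    also have "\<dots> = - (2 * \<mu> ^ 4 - 14 * \<mu> ^ 3 + 19 * \<mu>\<^sup>2 - 10 * \<mu> - 1)"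
      by algebra
    finally show ?thesis .
  qed
  moreover have "\<dots> \<ge> 0"
    using mu_upper_quartic[of \<mu>] assms \<mu> by simp
  ultimately have "(4 * m\<^sup>2 - 6 * (\<mu> - 2) * m + 9) * (\<mu> - 1)\<^sup>2 \<ge> 0"
    by linarith
  moreover have "(\<mu> - 1)\<^sup>2 > 0"
    using \<mu> by simp
  ultimately have "4 * m\<^sup>2 - 6 * (\<mu> - 2) * m + 9 \<ge> 0"
    by (meson zero_le_mult_iff not_le)
  then have "(4 * m\<^sup>2 - 6 * (\<mu> - 2) * m + 9) / (4 * m\<^sup>2) \<ge> 0"
    by simp
  also have "(4 * m\<^sup>2 - 6 * (\<mu> - 2) * m + 9) / (4 * m\<^sup>2) = y\<^sup>2 + (\<mu> - 2) * y + 1"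
    using m by (simp add: y_def divide_simps) (simp add: power2_eq_square algebra_simps)
  also have "\<dots> = (y - \<theta>) * (y + \<theta> + \<mu> - 2)"
    using root by algebra
  \<comment> \<open>The second factor is the distance from y to the other root 2 - \<mu> - \<theta>.
    It is positive by the crude bounds on y, \<theta> and \<mu>, so the first factor is
    nonnegative.\<close>
  finally have "\<theta> \<le> y"
    using y \<theta> \<mu> by (simp add: zero_le_mult_iff)
  then have "- (2 * \<theta> * m) \<ge> 3"
    using m by (simp add: y_def field_simps)
  moreover have "2 * (\<theta> * (\<theta> - c)) = - (2 * \<theta> * m) - 2"
    using root unfolding m_def by algebra
  ultimately have "1 \<le> 2 * (\<theta> * (\<theta> - c))"
    by linarith
  moreover have pos: "\<theta> * (\<theta> - c) > 0"
    using \<theta> c by (intro mult_neg_neg) auto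
  ultimately have "c / (\<theta> * (\<theta> - c)) \<le> 2 * c"
    using c mult_left_mono[of 1 "2 * (\<theta> * (\<theta> - c))" c]
    by (simp add: pos_divide_le_eq mult_ac)
  also have "c / (\<theta> * (\<theta> - c)) = 1 / (\<theta> - c) - 1 / \<theta>"
    using \<theta> c by (simp add: field_simps)
  finally have "1 / (\<theta> - c) - 1 / \<theta> \<le> 2 * c" .
  moreover have "2 - \<mu> = \<theta> + 1 / \<theta>"
    using root \<theta> by (simp add: divide_simps) algebra
  ultimately show ?thesis
    unfolding shearer_psi_def \<theta>_def[symmetric] by linarith
qed

lemma shearer_r_inner_1_eq:
  assumes "\<mu> \<in> {mu_lower..mu_upper}"
  shows "shearer_r_inner \<mu> (Suc 0) = 3"
proof -
  define c where "c = \<mu> / (\<mu> - 1)"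
  have \<mu>: "5.3722 < \<mu>" "\<mu> < 5.4208"
    using assms mu_lower_decimal mu_upper_decimal by auto
  have "c > 1.2" "c < 1.23"
    using \<mu> by (auto simp: c_def field_simps)
  with \<mu> shearer_theta_neg[of \<mu>] shearer_theta_gt[of \<mu>]
  have "\<lfloor>(\<mu> - 1) / \<mu> * (shearer_theta \<mu> - (1 - \<mu>))\<rfloor> = 3"
    by (intro floor_scaled_eqI; (fold c_def)?) auto
  then show ?thesis
    by simp
qed

text \<open>The bounds on \<open>shearer_psi \<mu> t\<close> are those on t shifted down by c. The
  left end is strict because the floor equals 1 only if
  \<open>\<theta>' - shearer_psi \<mu> t < 2 * c\<close>.\<close>

lemma shearer_interval_step:
  assumes "\<mu> \<in> {mu_lower..mu_upper}"
  defines "c \<equiv> \<mu> / (\<mu> - 1)"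
  assumes "shearer_theta \<mu> - c < t" "t \<le> 1 - \<mu> + 3 * c"
  shows "shearer_theta \<mu> - 2 * c < shearer_psi \<mu> t"
    and "shearer_psi \<mu> t \<le> 1 - \<mu> + 2 * c"
    and "\<lfloor>(\<mu> - 1) / \<mu> * (shearer_theta \<mu> - shearer_psi \<mu> t)\<rfloor> = 1"
    and "\<lfloor>(\<mu> - 1) / \<mu> * (shearer_theta \<mu> + 1 - shearer_psi \<mu> t)\<rfloor> = 2"
proof -
  have \<mu>: "5.3722 < \<mu>" "\<mu> < 5.4208"
    using assms mu_lower_decimal mu_upper_decimal by auto
  have c: "c > 1.2" "c < 1.23"
    using \<mu> by (auto simp: c_def field_simps)
  have neg: "1 - \<mu> + 3 * c < 0"
    using \<mu> c by simp
  have \<theta>: "shearer_theta \<mu> > - 0.4"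
    using shearer_theta_gt[of \<mu>] \<mu> by simp
  show lower: "shearer_theta \<mu> - 2 * c < shearer_psi \<mu> t"
    using shearer_psi_ge_lower[OF assms(1)] shearer_psi_strict_mono[OF assms(3), of \<mu>] assms(4) neg
    unfolding c_def by linarith
  show upper: "shearer_psi \<mu> t \<le> 1 - \<mu> + 2 * c"
    using shearer_psi_le_upper[OF assms(1)] shearer_psi_mono[OF assms(4) neg, of \<mu>]
    unfolding c_def by linarith
  show "\<lfloor>(\<mu> - 1) / \<mu> * (shearer_theta \<mu> - shearer_psi \<mu> t)\<rfloor> = 1"
    by (rule floor_scaled_eqI; (fold c_def)?) (use lower upper \<mu> c \<theta> in auto)
  \<comment> \<open>The tightest estimate: the lower bound needs
    \<open>4 * c \<le> \<theta>' + \<mu>\<close>, and 4 * 1.23 = 4.92 < 5.3722 - 0.4. The upper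
    bound follows from c > 1.\<close>
  show "\<lfloor>(\<mu> - 1) / \<mu> * (shearer_theta \<mu> + 1 - shearer_psi \<mu> t)\<rfloor> = 2"
    by (rule floor_scaled_eqI; (fold c_def)?) (use lower upper \<mu> c \<theta> in auto)
qed

lemma shearer_S_interval:
  assumes "\<mu> \<in> {mu_lower..mu_upper}"
  defines "c \<equiv> \<mu> / (\<mu> - 1)"
  shows "shearer_theta \<mu> - c < shearer_S \<mu> (Suc j) \<and> shearer_S \<mu> (Suc j) \<le> 1 - \<mu> + 3 * c"
proof (induction j)
  case 0
  have \<mu>: "5.3722 < \<mu>" "\<mu> < 5.4208"
    using assms mu_lower_decimal mu_upper_decimal by auto
  then have "c > 1.2"
    by (auto simp: c_def field_simps)
  with \<mu> shearer_theta_neg[of \<mu>] shearer_r_inner_1_eq[OF assms(1)] show ?case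
    by (simp flip: c_def)
next
  case (Suc j)
  \<comment> \<open>The next coefficient is 1, so c is added to \<open>shearer_psi\<close>, which
    shifts its bounds back to the original interval.\<close>
  note step = shearer_interval_step[OF assms(1), folded c_def, OF conjunct1[OF Suc] conjunct2[OF Suc]]
  then show ?case
    by (simp flip: c_def)
qed

lemma shearer_r_inner_eq_1:
  assumes "\<mu> \<in> {mu_lower..mu_upper}" "j \<ge> 2"
  shows "shearer_r_inner \<mu> j = 1"
proof -
  obtain i where "j = Suc (Suc i)"
    using assms(2) by (metis Suc_le_D numeral_2_eq_2 Suc_le_mono)
  then show ?thesis
    using shearer_interval_step(3)[OF assms(1)] shearer_S_interval[OF assms(1), of i] by simp
qed

theorem lemma3p7:
  fixes \<mu> :: real and k :: nat
  assumes "\<mu> \<in> {mu_lower..mu_upper}" and "k \<ge> 3"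
  shows "shearer_G \<mu> k = caterpillar ([3] @ replicate (k - 2) 1 @ [2]) \<and>
    shearer_r \<mu> k 1 = 3 \<and> (\<forall>j\<in>{2..k - 1}. shearer_r \<mu> k j = 1) \<and> shearer_r \<mu> k k = 2"
proof -
  have first: "shearer_r \<mu> k 1 = 3"
    using assms shearer_r_inner_1_eq[of \<mu>] by (simp add: shearer_r_def)
  have inner: "shearer_r \<mu> k j = 1" if "j \<in> {2..k - 1}" for j
    using that assms shearer_r_inner_eq_1[of \<mu> j] by (auto simp: shearer_r_def)
  \<comment> \<open>The invariant is stated at \<open>Suc j\<close>, so j = k - 2 gives
    \<open>S\<^sub>k\<^sub>-\<^sub>1\<close>.\<close>
  have last: "shearer_r \<mu> k k = 2"
    using shearer_interval_step(4)[OF assms(1)] shearer_S_interval[OF assms(1), of "k - 2"] assms(2)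
    by (simp add: shearer_r_def Suc_diff_Suc numeral_2_eq_2)
  have "map (\<lambda>j. nat (shearer_r \<mu> k j)) [1..<k + 1] = [3] @ replicate (k - 2) 1 @ [2]"
  proof (rule nth_equalityI)
    fix i
    assume "i < length (map (\<lambda>j. nat (shearer_r \<mu> k j)) [1..<k + 1])"
    then have "i < k" by (simp del: upt_Suc)
    then consider "i = 0" | "1 \<le> i" "i < k - 1" | "i = k - 1"
      by linarith
    then show "map (\<lambda>j. nat (shearer_r \<mu> k j)) [1..<k + 1] ! i = ([3] @ replicate (k - 2) 1 @ [2]) ! i"
    proof cases
      case 1
      then show ?thesis using first assms by (simp del: upt_Suc)
    next
      case 2
      then show ?thesis using inner[of "i + 1"] by (simp del: upt_Suc add: nth_Cons' nth_append)
    next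
      case 3
      then show ?thesis using last assms by (simp del: upt_Suc add: nth_Cons' nth_append numeral_2_eq_2)
    qed
  qed (use assms in auto)
  then show ?thesis
    unfolding shearer_G_def using first inner last by simp
qed

end
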